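(* Let $n\geq 1$, let $Y \subset \mathbb{R}^n$ be a nonempty closed convex set, and let $J:\mathbb{R}^n \to \mathbb{R}$ be a Fréchet differentiable function satisfying the following conditions: (a) $\lim_{\|x\|\to+\infty} J(x) =+\infty$; (b) $\nabla J$ is Lipschitzian on $\mathbb{R}^n$, with Lipschitz constant $L$. Define $\mathcal{L}(x,y):= J(x+y)-\frac{L}{2}\|y\|^2$ for $x,y\in\mathbb{R}^n$. Then $$\inf_{x\in \mathbb{R}^n} J(x) -\frac{L}{2}\inf_{y\in Y}\|y\|^2= \inf_{x\in \mathbb{R}^n}\, \sup_{y\in Y} \left(J(x+y)-\frac{L}{2}\|y\|^2\right)$$ or, equivalently, $$\sup_{y\in Y}\,\inf_{x\in\mathbb{R}^n}\mathcal{L}(x,y)=\inf_{x\in \mathbb{R}^n}\,\sup_{y\in Y}\mathcal{L}(x,y).$$ Furthermore, $\mathcal{L}$ has a saddle point on $\mathbb{R}^n\times Y$, that is, there exists $(\bar{x},\bar{y})\in \mathbb{R}^n\times Y$ satisfying $$\mathcal{L}(\bar{x},y) \leq \mathcal{L}(\bar{x},\bar{y})\leq \mathcal{L}(x,\bar{y})\quad\text{for all } (x,y)\in \mathbb{R}^n\times Y.$$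
   Context: $\|\cdot\|$ is the Euclidean norm on $\mathbb{R}^n$. "$\nabla J$ is Lipschitzian with Lipschitz constant $L$" means $\|\nabla J(x)-\nabla J(x')\|\leq L\|x-x'\|$ for all $x,x'\in\mathbb{R}^n$. Suprema and infima are taken in the extended real line $[-\infty,+\infty]$. *)

theory Defs
  imports "HOL-Analysis.Analysis"
begin

text \<open>
  The Riesz representative of the Frechet derivative; it is meaningful only at points of
  differentiability, see \<open>GDERIV_gradient\<close> below.
\<close>

definition gradient :: "('a::real_inner \<Rightarrow> real) \<Rightarrow> 'a \<Rightarrow> 'a"
  where "gradient J x = (THE D. GDERIV J x :> D)"

lemma GDERIV_unique:
  fixes J :: "'a::real_inner \<Rightarrow> real"
  assumes "GDERIV J x :> D" "GDERIV J x :> D'"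
  shows "D = D'"
proof -
  have "(\<lambda>h. inner h D) = (\<lambda>h. inner h D')"
    using assms unfolding gderiv_def by (rule has_derivative_unique)
  then have "inner h (D - D') = 0" for h
    by (metis inner_diff_right right_minus_eq)
  then have "inner (D - D') (D - D') = 0" by blast
  then show ?thesis by simp
qed

lemma gradient_eqI: "GDERIV J x :> D \<Longrightarrow> gradient J x = D"
  unfolding gradient_def by (blast intro: GDERIV_unique)

lemma GDERIV_gradient:
  fixes J :: "'a::euclidean_space \<Rightarrow> real"
  assumes "J differentiable at x"
  shows "GDERIV J x :> gradient J x"
proof -
  obtain J' where J': "(J has_derivative J') (at x)"
    using assms unfolding differentiable_def by blast
  then have lin: "linear J'"
    by (rule has_derivative_linear)
  have "J' = (\<lambda>h. inner h (adjoint J' 1))"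
    using adjoint_works[OF lin, of _ 1] by (auto simp: fun_eq_iff)
  with J' have "GDERIV J x :> adjoint J' 1"
    unfolding gderiv_def by metis
  then show ?thesis
    using gradient_eqI by metis
qed

definition lagr :: "('a::real_normed_vector \<Rightarrow> real) \<Rightarrow> real \<Rightarrow> 'a \<Rightarrow> 'a \<Rightarrow> real"
  where "lagr J L x y = J (x + y) - L / 2 * (norm y)\<^sup>2"

end

theory Submission
  imports Defs
begin

text \<open>
  The saddle point can be written down. A coercive differentiable \<open>J\<close> has a global minimiser
  \<open>z\<close>, and \<open>Y\<close> has a point \<open>p\<close> of least norm; the pair \<open>(z - p, p)\<close> is a saddle point.

  In the first variable this is clear: \<open>\<L>(x, p)\<close> is \<open>J (x + p)\<close> up to a constant, so it is
  least when \<open>x + p = z\<close>. In the second variable, the Lipschitz gradient bounds \<open>J\<close> from above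
  by a parabola of curvature \<open>L\<close> around its minimiser: \<open>J (z + h) \<le> J z + L/2 \<parallel>h\<parallel>\<^sup>2\<close>
  (\<open>descent_lemma\<close>). With \<open>h = y - p\<close> the term \<open>- L/2 \<parallel>y\<parallel>\<^sup>2\<close> cancels the quadratic part in \<open>y\<close>:
  \<open>\<L>(z - p, y) \<le> J z + L/2 (\<parallel>y - p\<parallel>\<^sup>2 - \<parallel>y\<parallel>\<^sup>2) = J z + L/2 (\<parallel>p\<parallel>\<^sup>2 - 2 \<langle>p, y\<rangle>)\<close>,
  and \<open>\<langle>p, y\<rangle> \<ge> \<parallel>p\<parallel>\<^sup>2\<close> on \<open>Y\<close>, because \<open>p\<close> is the projection of the origin on a convex set.
  The right-hand side is therefore at most \<open>J z - L/2 \<parallel>p\<parallel>\<^sup>2 = \<L>(z - p, p)\<close>.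

  Both minimax values equal the value at the saddle point, \<open>J z - L/2 \<parallel>p\<parallel>\<^sup>2\<close>, which is also
  \<open>inf J - L/2 inf\<^bsub>y \<in> Y\<^esub> \<parallel>y\<parallel>\<^sup>2\<close>.
\<close>

lemma coercive_attains_inf:
  fixes J :: "'a::euclidean_space \<Rightarrow> real"
  assumes cont: "continuous_on UNIV J" and coercive: "filterlim J at_top at_infinity"
  obtains z where "\<And>x. J z \<le> J x"
proof -
  have "\<forall>\<^sub>F x in at_infinity. J 0 \<le> J x"
    using coercive unfolding filterlim_at_top by blast
  then obtain b where b: "\<And>x. norm x \<ge> b \<Longrightarrow> J 0 \<le> J x"
    unfolding eventually_at_infinity by blast
  \<comment> \<open>\<open>b\<close> may be negative, but the ball has to contain the origin.\<close>
  define r where "r = max b 0"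
  have "compact (cball (0::'a) r)" "cball (0::'a) r \<noteq> {}"
    by (auto simp: r_def)
  then obtain z where z: "\<forall>x\<in>cball 0 r. J z \<le> J x"
    using continuous_attains_inf[OF _ _ continuous_on_subset[OF cont subset_UNIV]] by blast
  have "J z \<le> J x" for x
  proof (cases "norm x \<le> r")
    case True
    then show ?thesis using z by simp
  next
    case False
    then have "J 0 \<le> J x" by (intro b) (simp add: r_def)
    moreover have "J z \<le> J 0" using z by (simp add: r_def)
    ultimately show ?thesis by simp
  qed
  then show ?thesis by (rule that)
qed

lemma gradient_eq_0_at_minimum:
  fixes J :: "'a::euclidean_space \<Rightarrow> real"
  assumes diff: "J differentiable at z" and min: "\<And>x. J z \<le> J x"
  shows "gradient J z = 0"
proof -
  have "(J has_derivative (\<lambda>h. inner h (gradient J z))) (at z)"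
    using GDERIV_gradient[OF diff] unfolding gderiv_def .
  then have "(\<lambda>h. inner h (gradient J z)) = (\<lambda>h. 0)"
    by (rule differential_zero_maxmin[OF UNIV_I open_UNIV]) (use min in auto)
  then have "inner (gradient J z) (gradient J z) = 0" by (rule fun_cong)
  then show ?thesis by simp
qed

text \<open>
  Along the segment from \<open>x\<close> to \<open>x + h\<close> the slope of \<open>J\<close> at time \<open>t\<close> differs from the initial
  slope \<open>\<langle>h, \<nabla>J x\<rangle>\<close> by at most \<open>\<parallel>h\<parallel> \<cdot> L t \<parallel>h\<parallel>\<close>, by Cauchy-Schwarz; hence \<open>J\<close> minus the
  quadratic with that initial slope and curvature \<open>L \<parallel>h\<parallel>\<^sup>2\<close> is nonincreasing in \<open>t \<ge> 0\<close>.
\<close>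

lemma descent_lemma:
  fixes J :: "'a::euclidean_space \<Rightarrow> real"
  assumes diff: "\<And>x. J differentiable at x"
    and lipschitz: "\<And>x x'. norm (gradient J x - gradient J x') \<le> L * norm (x - x')"
  shows "J (x + h) \<le> J x + inner h (gradient J x) + L / 2 * (norm h)\<^sup>2"
proof -
  define \<phi> where
    "\<phi> t = J (x + t *\<^sub>R h) - t * inner h (gradient J x) - L / 2 * t\<^sup>2 * (norm h)\<^sup>2" for t
  define \<phi>' where
    "\<phi>' t = inner h (gradient J (x + t *\<^sub>R h)) - inner h (gradient J x) - L * t * (norm h)\<^sup>2" for t
  have deriv: "(\<phi> has_real_derivative \<phi>' t) (at t)" for t
  proof -
    have "((\<lambda>t. x + t *\<^sub>R h) has_derivative (\<lambda>s. s *\<^sub>R h)) (at t)"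
      by (auto intro!: derivative_eq_intros)
    moreover have "(J has_derivative (\<lambda>k. inner k (gradient J (x + t *\<^sub>R h)))) (at (x + t *\<^sub>R h))"
      using GDERIV_gradient[OF diff] unfolding gderiv_def .
    ultimately have "((\<lambda>t. J (x + t *\<^sub>R h)) has_derivative
        (\<lambda>s. inner (s *\<^sub>R h) (gradient J (x + t *\<^sub>R h)))) (at t)"
      by (rule has_derivative_compose)
    then have "((\<lambda>t. J (x + t *\<^sub>R h)) has_real_derivative
        inner h (gradient J (x + t *\<^sub>R h))) (at t)"
      by (simp add: has_field_derivative_def mult_commute_abs)
    moreover have "((\<lambda>t. t * c) has_real_derivative c) (at t)" for c
      by (auto intro!: derivative_eq_intros)
    moreover have "((\<lambda>t. L / 2 * t\<^sup>2 * (norm h)\<^sup>2) has_real_derivative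
        L * t * (norm h)\<^sup>2) (at t)"
      by (auto intro!: derivative_eq_intros)
    ultimately show ?thesis
      unfolding \<phi>_def[abs_def] \<phi>'_def by (intro DERIV_diff)
  qed
  have slope: "\<phi>' t \<le> 0" if "0 \<le> t" for t
  proof -
    have "inner h (gradient J (x + t *\<^sub>R h) - gradient J x)
        \<le> norm h * norm (gradient J (x + t *\<^sub>R h) - gradient J x)"
      by (rule norm_cauchy_schwarz)
    also have "\<dots> \<le> norm h * (L * norm (t *\<^sub>R h))"
      using lipschitz[of "x + t *\<^sub>R h" x] by (intro mult_left_mono) auto
    also have "\<dots> = L * t * (norm h)\<^sup>2"
      using that by (simp add: power2_eq_square)
    finally show ?thesis by (simp add: \<phi>'_def inner_diff_right)
  qed
  have "\<phi> 1 \<le> \<phi> 0"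
  proof (rule DERIV_nonpos_imp_nonincreasing[of 0 1 \<phi>])
    show "\<exists>y. (\<phi> has_real_derivative y) (at t) \<and> y \<le> 0" if "0 \<le> t" for t
      by (intro exI[of _ "\<phi>' t"] conjI deriv slope that)
  qed simp
  then show ?thesis by (simp add: \<phi>_def)
qed

text \<open>
  A saddle point closes the duality gap: \<open>inf sup \<le> sup f(a, \<sqdot>) \<le> f(a, b) \<le> inf f(\<sqdot>, b) \<le> sup inf\<close>,
  while \<open>sup inf \<le> inf sup\<close> always holds.
\<close>

lemma saddle_point_minimax:
  fixes f :: "'a \<Rightarrow> 'b \<Rightarrow> 'c::complete_lattice"
  assumes "a \<in> X" "b \<in> Y"
    and max: "\<And>y. y \<in> Y \<Longrightarrow> f a y \<le> f a b"
    and min: "\<And>x. x \<in> X \<Longrightarrow> f a b \<le> f x b"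
  shows "(INF x\<in>X. SUP y\<in>Y. f x y) = f a b" and "(SUP y\<in>Y. INF x\<in>X. f x y) = f a b"
proof -
  have "(INF x\<in>X. SUP y\<in>Y. f x y) \<le> (SUP y\<in>Y. f a y)"
    using \<open>a \<in> X\<close> by (rule INF_lower)
  also have "\<dots> \<le> f a b"
    using max by (rule SUP_least)
  finally have upper: "(INF x\<in>X. SUP y\<in>Y. f x y) \<le> f a b" .
  have "f a b \<le> (INF x\<in>X. f x b)"
    using min by (rule INF_greatest)
  also have "\<dots> \<le> (SUP y\<in>Y. INF x\<in>X. f x y)"
    using \<open>b \<in> Y\<close> by (rule SUP_upper)
  finally have lower: "f a b \<le> (SUP y\<in>Y. INF x\<in>X. f x y)" .
  have "(SUP y\<in>Y. INF x\<in>X. f x y) \<le> (INF x\<in>X. SUP y\<in>Y. f x y)"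
    by (intro SUP_least INF_greatest) (meson INF_lower SUP_upper order_trans)
  then show "(INF x\<in>X. SUP y\<in>Y. f x y) = f a b" "(SUP y\<in>Y. INF x\<in>X. f x y) = f a b"
    using upper lower by order+
qed

text \<open>
  The hypothesis on \<open>p\<close> is the variational inequality that characterises the point of least norm
  when \<open>Y\<close> is closed and convex and \<open>p \<in> Y\<close>. It enters multiplied by \<open>L\<close>, hence the sign
  condition.
\<close>

lemma saddle_point_lagr:
  fixes J :: "'a::euclidean_space \<Rightarrow> real"
  assumes diff: "\<And>x. J differentiable at x"
    and lipschitz: "\<And>x x'. norm (gradient J x - gradient J x') \<le> L * norm (x - x')"
    and "0 \<le> L"
    and min: "\<And>x. J z \<le> J x"
    and p: "\<And>y. y \<in> Y \<Longrightarrow> (norm p)\<^sup>2 \<le> inner y p"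
  shows "y \<in> Y \<Longrightarrow> lagr J L (z - p) y \<le> lagr J L (z - p) p"
    and "lagr J L (z - p) p \<le> lagr J L x p"
proof -
  assume "y \<in> Y"
  have "J (z + (y - p)) \<le> J z + L / 2 * (norm (y - p))\<^sup>2"
    using descent_lemma[OF diff lipschitz, of z "y - p"] gradient_eq_0_at_minimum[OF diff min]
    by simp
  also have "(norm (y - p))\<^sup>2 = (norm y)\<^sup>2 - 2 * inner y p + (norm p)\<^sup>2"
    by (simp add: power2_norm_eq_inner inner_diff_left inner_diff_right inner_commute)
  also have "L / 2 * \<dots> \<le> L / 2 * ((norm y)\<^sup>2 - (norm p)\<^sup>2)"
    using p[OF \<open>y \<in> Y\<close>] \<open>0 \<le> L\<close> by (intro mult_left_mono) auto
  finally show "lagr J L (z - p) y \<le> lagr J L (z - p) p"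
    by (simp add: lagr_def algebra_simps)
next
  show "lagr J L (z - p) p \<le> lagr J L x p"
    using min by (simp add: lagr_def)
qed

theorem theorem2p3:
  fixes Y :: "(real ^ 'n) set"
    and J :: "real ^ 'n \<Rightarrow> real"
    and L :: real
  assumes "Y \<noteq> {}" and "closed Y" and "convex Y"
    and "\<And>x. J differentiable at x"
    and "filterlim J at_top at_infinity"
    and "\<And>x x'. norm (gradient J x - gradient J x') \<le> L * norm (x - x')"
  shows "(INF x. ereal (J x)) - ereal (L / 2) * (INF y\<in>Y. ereal ((norm y)\<^sup>2))
           = (INF x. SUP y\<in>Y. ereal (J (x + y) - L / 2 * (norm y)\<^sup>2))
       \<and> (SUP y\<in>Y. INF x. ereal (lagr J L x y)) = (INF x. SUP y\<in>Y. ereal (lagr J L x y))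
       \<and> (\<exists>xb. \<exists>yb\<in>Y. \<forall>x. \<forall>y\<in>Y.
             lagr J L xb y \<le> lagr J L xb yb \<and> lagr J L xb yb \<le> lagr J L x yb)"
proof -
  have "continuous_on UNIV J"
    using assms(4) by (simp add: continuous_at_imp_continuous_on differentiable_imp_continuous_within)
  then obtain z where z: "\<And>x. J z \<le> J x"
    using coercive_attains_inf assms(5) by blast
  define p where "p = closest_point Y 0"
  have "p \<in> Y"
    unfolding p_def using closest_point_in_set assms(1,2) by blast
  have p_inner: "(norm p)\<^sup>2 \<le> inner y p" if "y \<in> Y" for y
    using closest_point_dot[OF assms(3,2) that, of 0]
    by (simp add: p_def[symmetric] power2_norm_eq_inner inner_diff_right inner_commute)
  have p_norm: "norm p \<le> norm y" if "y \<in> Y" for y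
    using closest_point_le[OF assms(2) that, of 0] by (simp add: p_def)
  \<comment> \<open>The space contains a vector of norm 1, so the Lipschitz condition forces \<open>L \<ge> 0\<close>.\<close>
  obtain e :: "real ^ 'n" where "norm e = 1"
    using vector_choose_size zero_le_one by blast
  then have "0 \<le> L"
    using order_trans[OF norm_ge_zero assms(6)[of e 0]] by simp
  note saddle = saddle_point_lagr[where J = J and L = L and z = z and p = p and Y = Y,
    OF assms(4,6) \<open>0 \<le> L\<close> z p_inner]
  note minimax = saddle_point_minimax[of "z - p" UNIV p Y "\<lambda>x y. ereal (lagr J L x y)"]
  have inf_sup: "(INF x. SUP y\<in>Y. ereal (lagr J L x y)) = ereal (lagr J L (z - p) p)"
    by (rule minimax(1)) (simp_all add: saddle \<open>p \<in> Y\<close>)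
  have sup_inf: "(SUP y\<in>Y. INF x. ereal (lagr J L x y)) = ereal (lagr J L (z - p) p)"
    by (rule minimax(2)) (simp_all add: saddle \<open>p \<in> Y\<close>)
  have inf_J: "(INF x. ereal (J x)) = ereal (J z)"
    using z by (intro antisym INF_lower2[of z] INF_greatest) auto
  have inf_norm: "(INF y\<in>Y. ereal ((norm y)\<^sup>2)) = ereal ((norm p)\<^sup>2)"
    using p_norm \<open>p \<in> Y\<close> by (intro antisym INF_lower2[of p] INF_greatest) auto
  show ?thesis
  proof (intro conjI)
    show "(INF x. ereal (J x)) - ereal (L / 2) * (INF y\<in>Y. ereal ((norm y)\<^sup>2))
        = (INF x. SUP y\<in>Y. ereal (J (x + y) - L / 2 * (norm y)\<^sup>2))"
      unfolding inf_J inf_norm inf_sup[unfolded lagr_def] by simp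
    show "(SUP y\<in>Y. INF x. ereal (lagr J L x y)) = (INF x. SUP y\<in>Y. ereal (lagr J L x y))"
      unfolding sup_inf inf_sup ..
    show "\<exists>xb. \<exists>yb\<in>Y. \<forall>x. \<forall>y\<in>Y.
        lagr J L xb y \<le> lagr J L xb yb \<and> lagr J L xb yb \<le> lagr J L x yb"
      by (intro exI[of _ "z - p"] bexI[OF _ \<open>p \<in> Y\<close>] allI ballI conjI saddle)
  qed
qed

end
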